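(* Let $\Omega$ be a semigroup with unit $1$ and let $(A,\{N_\omega\}_{\omega\in\Omega})$ be a Nijenhuis family $\Omega$-associative algebra. Two isomorphic abelian extensions of $(A,\{N_\omega\}_{\omega\in\Omega})$ by $(M,\{N_{M,\omega}\}_{\omega\in\Omega})$ give rise to the same cohomology class in $\mathrm{H}^2_{\mathrm{NFA}}(A,M)$, where the class attached to an abelian extension is that of the pair $(\{\psi_{\alpha,\beta}\}_{\alpha,\beta\in\Omega},\{\chi_\omega\}_{\omega\in\Omega})$ defined from any family of sections $\{s_\omega\}_{\omega\in\Omega}$ by $$\psi_{\alpha,\beta}(a,b)=s_\alpha(a)\cdot_{\alpha,\beta}s_\beta(b)-s_{\alpha\beta}(a\cdot_{\alpha,\beta}b),\qquad\chi_\omega(a)=\hat N_\omega(s_\omega(a))-s_\omega(N_\omega(a)).$$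
   Context: All vector spaces are over a field $\mathbf{k}$. An $\Omega$-associative algebra is a vector space $A$ with bilinear operations $\cdot_{\alpha,\beta}:A\otimes A\to A$ ($\alpha,\beta\in\Omega$) such that $(a\cdot_{\alpha,\beta}b)\cdot_{\alpha\beta,\gamma}c=a\cdot_{\alpha,\beta\gamma}(b\cdot_{\beta,\gamma}c)$. A Nijenhuis family $\Omega$-associative algebra is an $\Omega$-associative algebra with linear maps $N_\omega:A\to A$ such that $N_\alpha(a)\cdot_{\alpha,\beta}N_\beta(b)=N_{\alpha\beta}\big(N_\alpha(a)\cdot_{\alpha,\beta}b+a\cdot_{\alpha,\beta}N_\beta(b)-N_{\alpha\beta}(a\cdot_{\alpha,\beta}b)\big)$. A morphism is a family of linear maps $f_\omega:A\to A'$ with $f_\omega\circ N_\omega=N'_\omega\circ f_\omega$ and $f_{\alpha\beta}(a\cdot_{\alpha,\beta}b)=f_\alpha(a)\cdot'_{\alpha,\beta}f_\beta(b)$; it is an isomorphism if every $f_\omega$ is bijective. An abelian extension of $(A,\{N_\omega\})$ by $(M,\{N_{M,\omega}\})$ (a vector space with linear maps $N_{M,\omega}:M\to M$, and zero product) is a Nijenhuis family $\Omega$-associative algebra $(\hat A,\{\hat N_\omega\})$ with morphisms $\{i_\omega:M\to\hat A\}$ and $\{p_\omega:\hat A\to A\}$ of Nijenhuis family $\Omega$-associative algebras such that $0\to M\xrightarrow{i_\omega}\hat A\xrightarrow{p_\omega}A\to0$ is exact for each $\omega$. Two abelian extensions $(\hat A_1,i^1,p^1)$, $(\hat A_2,i^2,p^2)$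 are isomorphic if there is an isomorphism of Nijenhuis family $\Omega$-associative algebras $\{\zeta_\omega\}:\hat A_1\to\hat A_2$ with $\zeta_\omega\circ i^1_\omega=i^2_\omega$ and $p^2_\omega\circ\zeta_\omega=p^1_\omega$ for all $\omega$. A section is a linear map $s_\omega:A\to\hat A$ with $p_\omega\circ s_\omega=\mathrm{id}_A$. $M$ is regarded inside $\hat A$ via the $i_\omega$; in particular $i_{\alpha\beta}(\psi_{\alpha,\beta}(a,b))=s_\alpha(a)\cdot_{\alpha,\beta}s_\beta(b)-s_{\alpha\beta}(a\cdot_{\alpha,\beta}b)$ and $i_\omega(\chi_\omega(a))=\hat N_\omega(s_\omega(a))-s_\omega(N_\omega(a))$. The actions of $A$ on $M$ used below are those induced by the extension: $i_{\alpha\beta}(a\cdot_{\alpha,\beta}m)=s_\alpha(a)\cdot_{\alpha,\beta}i_\beta(m)$, $i_{\alpha\beta}(m\cdot_{\alpha,\beta}a)=i_\alpha(m)\cdot_{\alpha,\beta}s_\beta(a)$ (independent of the choice of sections). Cohomology: $\mathrm{H}^2_{\mathrm{NFA}}(A,M)=\ker d^2/\operatorname{im}d^1$. Here $C^1_{\mathrm{NFA}}(A,M)$ consists of pairs $(f,m)$ with $f=\{f_\alpha\}$ a family of linear maps $A\to M$ and $m\in M$; $C^2_{\mathrm{NFA}}(A,M)$ consists of pairs $(f,g)$ with $f=\{f_{\alpha,\beta}\}$ a family of linear maps $A^{\otimes2}\to M$ and $g=\{g_\alpha\}$ a family of linear maps $A\to M$; $d^1(f,m)=(\delta^1(f),-\partial^0(m)-\Phi^1(f))$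 and $d^2(f,g)=(\delta^2(f),-\partial^1(g)-\Phi^2(f))$, where $\delta^1(f)_{\alpha,\beta}(a,b)=a\cdot_{\alpha,\beta}f_\beta(b)-f_{\alpha\beta}(a\cdot_{\alpha,\beta}b)+f_\alpha(a)\cdot_{\alpha,\beta}b$; $\delta^2(f)_{\alpha,\beta,\gamma}(a,b,c)=-a\cdot_{\alpha,\beta\gamma}f_{\beta,\gamma}(b,c)+f_{\alpha\beta,\gamma}(a\cdot_{\alpha,\beta}b,c)-f_{\alpha,\beta\gamma}(a,b\cdot_{\beta,\gamma}c)+f_{\alpha,\beta}(a,b)\cdot_{\alpha\beta,\gamma}c$; $\partial^0(m)_\alpha(a)=N_\alpha(a)\cdot_{\alpha,1}m-m\cdot_{1,\alpha}N_\alpha(a)-N_{M,\alpha}(a\cdot_{\alpha,1}m-m\cdot_{1,\alpha}a)$; $\partial^1(g)_{\alpha,\beta}(a,b)=N_\alpha(a)\cdot_{\alpha,\beta}g_\beta(b)-N_{M,\alpha\beta}(a\cdot_{\alpha,\beta}g_\beta(b))-g_{\alpha\beta}\big(N_\alpha(a)\cdot_{\alpha,\beta}b+a\cdot_{\alpha,\beta}N_\beta(b)-N_{\alpha\beta}(a\cdot_{\alpha,\beta}b)\big)+g_\alpha(a)\cdot_{\alpha,\beta}N_\beta(b)-N_{M,\alpha\beta}(g_\alpha(a)\cdot_{\alpha,\beta}b)$; $\Phi^1(f)_\alpha(a)=f_\alpha(N_\alpha(a))-N_{M,\alpha}(f_\alpha(a))$; $\Phi^2(f)_{\alpha,\beta}(a,b)=f_{\alpha,\beta}(N_\alpha(a),N_\beta(b))-N_{M,\alpha\beta}f_{\alpha,\beta}(N_\alpha(a),b)-N_{M,\alpha\beta}f_{\alpha,\beta}(a,N_\beta(b))+N_{M,\alpha\beta}^2f_{\alpha,\beta}(a,b)$.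 Two elements are in the same cohomology class if their difference lies in $\operatorname{im}d^1$.
   Formalization: The formula for ∂^1(g)_{α,β}(a,b) is corrected by adding the summand N_{M,αβ}(g_{αβ}(a·_{α,β}b)); without it (ψ,χ) need not lie in ker d^2 and im d^1 is not contained in ker d^2; d^1 is unchanged. *)

theory Defs
  imports Main "HOL.Vector_Spaces" "HOL-Library.Function_Algebras" "HOL-Library.Product_Plus"
begin

section \<open>Nijenhuis family \<open>\<Omega>\<close>-associative algebras\<close>

text \<open>
  The semigroup \<open>\<Omega>\<close> is the type \<open>'w\<close>; a vector space over \<open>'k\<close> is a type in
  \<^class>\<open>ab_group_add\<close> together with a scalar multiplication satisfying \<^locale>\<open>vector_space\<close>.
\<close>

record ('k, 'w, 'a) family_alg =
  smul :: "'k \<Rightarrow> 'a \<Rightarrow> 'a"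
  mul :: "'w \<Rightarrow> 'w \<Rightarrow> 'a \<Rightarrow> 'a \<Rightarrow> 'a"
  nij :: "'w \<Rightarrow> 'a \<Rightarrow> 'a"

definition bilinear_map ::
    "('k::field \<Rightarrow> 'a::ab_group_add \<Rightarrow> 'a) \<Rightarrow> ('k \<Rightarrow> 'b::ab_group_add \<Rightarrow> 'b) \<Rightarrow>
     ('k \<Rightarrow> 'c::ab_group_add \<Rightarrow> 'c) \<Rightarrow> ('a \<Rightarrow> 'b \<Rightarrow> 'c) \<Rightarrow> bool" where
  "bilinear_map sa sb sc h \<longleftrightarrow>
     (\<forall>a. Vector_Spaces.linear sb sc (h a)) \<and> (\<forall>b. Vector_Spaces.linear sa sc (\<lambda>a. h a b))"

definition omega_associative_algebra ::
    "('k::field, 'w::semigroup_mult, 'a::ab_group_add) family_alg \<Rightarrow> bool" where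
  "omega_associative_algebra A \<longleftrightarrow>
     vector_space (smul A) \<and>
     (\<forall>\<alpha> \<beta>. bilinear_map (smul A) (smul A) (smul A) (mul A \<alpha> \<beta>)) \<and>
     (\<forall>\<alpha> \<beta> \<gamma> a b c.
        mul A (\<alpha> * \<beta>) \<gamma> (mul A \<alpha> \<beta> a b) c = mul A \<alpha> (\<beta> * \<gamma>) a (mul A \<beta> \<gamma> b c))"

definition nijenhuis_family_algebra ::
    "('k::field, 'w::semigroup_mult, 'a::ab_group_add) family_alg \<Rightarrow> bool" where
  "nijenhuis_family_algebra A \<longleftrightarrow>
     omega_associative_algebra A \<and>
     (\<forall>\<omega>. Vector_Spaces.linear (smul A) (smul A) (nij A \<omega>)) \<and>
     (\<forall>\<alpha> \<beta> a b.
        mul A \<alpha> \<beta> (nij A \<alpha> a) (nij A \<beta> b) =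
        nij A (\<alpha> * \<beta>)
          (mul A \<alpha> \<beta> (nij A \<alpha> a) b + mul A \<alpha> \<beta> a (nij A \<beta> b)
           - nij A (\<alpha> * \<beta>) (mul A \<alpha> \<beta> a b)))"

definition nfa_morphism ::
    "('k::field, 'w::semigroup_mult, 'a::ab_group_add) family_alg \<Rightarrow>
     ('k, 'w, 'b::ab_group_add) family_alg \<Rightarrow> ('w \<Rightarrow> 'a \<Rightarrow> 'b) \<Rightarrow> bool" where
  "nfa_morphism A B f \<longleftrightarrow>
     (\<forall>\<omega>. Vector_Spaces.linear (smul A) (smul B) (f \<omega>)) \<and>
     (\<forall>\<omega>. f \<omega> \<circ> nij A \<omega> = nij B \<omega> \<circ> f \<omega>) \<and>
     (\<forall>\<alpha> \<beta> a b. f (\<alpha> * \<beta>) (mul A \<alpha> \<beta> a b) = mul B \<alpha> \<beta> (f \<alpha> a) (f \<beta> b))"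

definition nfa_isomorphism ::
    "('k::field, 'w::semigroup_mult, 'a::ab_group_add) family_alg \<Rightarrow>
     ('k, 'w, 'b::ab_group_add) family_alg \<Rightarrow> ('w \<Rightarrow> 'a \<Rightarrow> 'b) \<Rightarrow> bool" where
  "nfa_isomorphism A B f \<longleftrightarrow> nfa_morphism A B f \<and> (\<forall>\<omega>. bij (f \<omega>))"


section \<open>Abelian extensions\<close>

record ('k, 'w, 'm, 'e, 'a) extension =
  total :: "('k, 'w, 'e) family_alg"
  incl :: "'w \<Rightarrow> 'm \<Rightarrow> 'e"
  proj :: "'w \<Rightarrow> 'e \<Rightarrow> 'a"

text \<open>
  A vector space \<open>M\<close> with a family of linear maps is encoded as a Nijenhuis family algebra
  whose products all vanish (the algebra axioms are then void).
\<close>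

definition abelian_extension ::
    "('k::field, 'w::semigroup_mult, 'a::ab_group_add) family_alg \<Rightarrow>
     ('k, 'w, 'm::ab_group_add) family_alg \<Rightarrow>
     ('k, 'w, 'm, 'e::ab_group_add, 'a) extension \<Rightarrow> bool" where
  "abelian_extension A M E \<longleftrightarrow>
     nijenhuis_family_algebra A \<and>
     nijenhuis_family_algebra M \<and> (\<forall>\<alpha> \<beta> x y. mul M \<alpha> \<beta> x y = 0) \<and>
     nijenhuis_family_algebra (total E) \<and>
     nfa_morphism M (total E) (incl E) \<and> nfa_morphism (total E) A (proj E) \<and>
     (\<forall>\<omega>. inj (incl E \<omega>) \<and> range (incl E \<omega>) = {x. proj E \<omega> x = 0} \<and> surj (proj E \<omega>))"

definition isomorphic_extensions ::
    "('k::field, 'w::semigroup_mult, 'm, 'e1::ab_group_add, 'a) extension \<Rightarrow>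
     ('k, 'w, 'm, 'e2::ab_group_add, 'a) extension \<Rightarrow> bool" where
  "isomorphic_extensions E1 E2 \<longleftrightarrow>
     (\<exists>\<zeta>. nfa_isomorphism (total E1) (total E2) \<zeta> \<and>
        (\<forall>\<omega>. \<zeta> \<omega> \<circ> incl E1 \<omega> = incl E2 \<omega> \<and> proj E2 \<omega> \<circ> \<zeta> \<omega> = proj E1 \<omega>))"

definition section_family ::
    "('k::field, 'w::semigroup_mult, 'a::ab_group_add) family_alg \<Rightarrow>
     ('k, 'w, 'm, 'e::ab_group_add, 'a) extension \<Rightarrow> ('w \<Rightarrow> 'a \<Rightarrow> 'e) \<Rightarrow> bool" where
  "section_family A E s \<longleftrightarrow>
     (\<forall>\<omega>. Vector_Spaces.linear (smul A) (smul (total E)) (s \<omega>) \<and> proj E \<omega> \<circ> s \<omega> = id)"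

text \<open>
  The actions of \<open>A\<close> on \<open>M\<close> induced by an abelian extension: by exactness the element
  described by \<open>THE\<close> exists, is unique, and is the same for all families of sections.
\<close>

definition left_action ::
    "('k::field, 'w::semigroup_mult, 'a::ab_group_add) family_alg \<Rightarrow>
     ('k, 'w, 'm::ab_group_add, 'e::ab_group_add, 'a) extension \<Rightarrow>
     'w \<Rightarrow> 'w \<Rightarrow> 'a \<Rightarrow> 'm \<Rightarrow> 'm" where
  "left_action A E \<alpha> \<beta> a m =
     (THE x. \<forall>s. section_family A E s \<longrightarrow>
        incl E (\<alpha> * \<beta>) x = mul (total E) \<alpha> \<beta> (s \<alpha> a) (incl E \<beta> m))"

definition right_action ::
    "('k::field, 'w::semigroup_mult, 'a::ab_group_add) family_alg \<Rightarrow>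
     ('k, 'w, 'm::ab_group_add, 'e::ab_group_add, 'a) extension \<Rightarrow>
     'w \<Rightarrow> 'w \<Rightarrow> 'm \<Rightarrow> 'a \<Rightarrow> 'm" where
  "right_action A E \<alpha> \<beta> m a =
     (THE x. \<forall>s. section_family A E s \<longrightarrow>
        incl E (\<alpha> * \<beta>) x = mul (total E) \<alpha> \<beta> (incl E \<alpha> m) (s \<beta> a))"

text \<open>
  The arguments of \<open>inv\<close> below lie in the image of the injective map \<open>incl E\<close>, because \<open>proj E\<close>
  sends them to \<open>0\<close>; so \<open>psi\<close> and \<open>chi\<close> are the elements of \<open>M\<close> that \<open>incl E\<close> maps to them.
\<close>

definition psi ::
    "('k::field, 'w::semigroup_mult, 'a::ab_group_add) family_alg \<Rightarrow>
     ('k, 'w, 'm::ab_group_add, 'e::ab_group_add, 'a) extension \<Rightarrow> ('w \<Rightarrow> 'a \<Rightarrow> 'e) \<Rightarrow>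
     'w \<Rightarrow> 'w \<Rightarrow> 'a \<Rightarrow> 'a \<Rightarrow> 'm" where
  "psi A E s \<alpha> \<beta> a b =
     inv (incl E (\<alpha> * \<beta>))
       (mul (total E) \<alpha> \<beta> (s \<alpha> a) (s \<beta> b) - s (\<alpha> * \<beta>) (mul A \<alpha> \<beta> a b))"

definition chi ::
    "('k::field, 'w::semigroup_mult, 'a::ab_group_add) family_alg \<Rightarrow>
     ('k, 'w, 'm::ab_group_add, 'e::ab_group_add, 'a) extension \<Rightarrow> ('w \<Rightarrow> 'a \<Rightarrow> 'e) \<Rightarrow>
     'w \<Rightarrow> 'a \<Rightarrow> 'm" where
  "chi A E s \<omega> a = inv (incl E \<omega>) (nij (total E) \<omega> (s \<omega> a) - s \<omega> (nij A \<omega> a))"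


section \<open>The second cohomology group\<close>

text \<open>
  In the following, \<open>l\<close> and \<open>r\<close> are the left and right actions of \<open>A\<close> on \<open>M\<close>.
  A linear map on a tensor square is rendered as a bilinear map.
\<close>

type_synonym ('w, 'a, 'm) cochain1 = "('w \<Rightarrow> 'a \<Rightarrow> 'm) \<times> 'm"
type_synonym ('w, 'a, 'm) cochain2 = "('w \<Rightarrow> 'w \<Rightarrow> 'a \<Rightarrow> 'a \<Rightarrow> 'm) \<times> ('w \<Rightarrow> 'a \<Rightarrow> 'm)"
type_synonym ('w, 'a, 'm) lact = "'w \<Rightarrow> 'w \<Rightarrow> 'a \<Rightarrow> 'm \<Rightarrow> 'm"
type_synonym ('w, 'a, 'm) ract = "'w \<Rightarrow> 'w \<Rightarrow> 'm \<Rightarrow> 'a \<Rightarrow> 'm"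

definition C1 ::
    "('k::field, 'w, 'a::ab_group_add) family_alg \<Rightarrow> ('k, 'w, 'm::ab_group_add) family_alg \<Rightarrow>
     ('w, 'a, 'm) cochain1 set" where
  "C1 A M = {(f, m). \<forall>\<alpha>. Vector_Spaces.linear (smul A) (smul M) (f \<alpha>)}"

definition C2 ::
    "('k::field, 'w, 'a::ab_group_add) family_alg \<Rightarrow> ('k, 'w, 'm::ab_group_add) family_alg \<Rightarrow>
     ('w, 'a, 'm) cochain2 set" where
  "C2 A M =
     {(f, g). (\<forall>\<alpha> \<beta>. bilinear_map (smul A) (smul A) (smul M) (f \<alpha> \<beta>)) \<and>
              (\<forall>\<alpha>. Vector_Spaces.linear (smul A) (smul M) (g \<alpha>))}"

definition delta1 ::
    "('k, 'w::semigroup_mult, 'a) family_alg \<Rightarrow>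
     ('w, 'a, 'm::ab_group_add) lact \<Rightarrow> ('w, 'a, 'm) ract \<Rightarrow>
     ('w \<Rightarrow> 'a \<Rightarrow> 'm) \<Rightarrow> 'w \<Rightarrow> 'w \<Rightarrow> 'a \<Rightarrow> 'a \<Rightarrow> 'm" where
  "delta1 A l r f \<alpha> \<beta> a b =
     l \<alpha> \<beta> a (f \<beta> b) - f (\<alpha> * \<beta>) (mul A \<alpha> \<beta> a b) + r \<alpha> \<beta> (f \<alpha> a) b"

definition delta2 ::
    "('k, 'w::semigroup_mult, 'a) family_alg \<Rightarrow>
     ('w, 'a, 'm::ab_group_add) lact \<Rightarrow> ('w, 'a, 'm) ract \<Rightarrow>
     ('w \<Rightarrow> 'w \<Rightarrow> 'a \<Rightarrow> 'a \<Rightarrow> 'm) \<Rightarrow> 'w \<Rightarrow> 'w \<Rightarrow> 'w \<Rightarrow> 'a \<Rightarrow> 'a \<Rightarrow> 'a \<Rightarrow> 'm" where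
  "delta2 A l r f \<alpha> \<beta> \<gamma> a b c =
     - l \<alpha> (\<beta> * \<gamma>) a (f \<beta> \<gamma> b c) + f (\<alpha> * \<beta>) \<gamma> (mul A \<alpha> \<beta> a b) c
     - f \<alpha> (\<beta> * \<gamma>) a (mul A \<beta> \<gamma> b c) + r (\<alpha> * \<beta>) \<gamma> (f \<alpha> \<beta> a b) c"

definition partial0 ::
    "('k, 'w::monoid_mult, 'a) family_alg \<Rightarrow> ('k, 'w, 'm) family_alg \<Rightarrow>
     ('w, 'a, 'm::ab_group_add) lact \<Rightarrow> ('w, 'a, 'm) ract \<Rightarrow>
     'm \<Rightarrow> 'w \<Rightarrow> 'a \<Rightarrow> 'm" where
  "partial0 A M l r m \<alpha> a =
     l \<alpha> 1 (nij A \<alpha> a) m - r 1 \<alpha> m (nij A \<alpha> a) - nij M \<alpha> (l \<alpha> 1 a m - r 1 \<alpha> m a)"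

text \<open>
  The last summand of \<open>partial1\<close>, \<open>N\<^bsub>M,\<alpha>\<beta>\<^esub> (g\<^bsub>\<alpha>\<beta>\<^esub> (a \<cdot>\<^bsub>\<alpha>,\<beta>\<^esub> b))\<close>, is missing in
  the formula found in the source, but it arises when the Nijenhuis identity is linearised,
  and without it neither \<open>d2 \<circ> d1 = 0\<close> holds nor are the pairs \<open>(psi, chi)\<close> cocycles.
  (Take \<open>\<Omega>\<close> trivial, \<open>A = k e\<close> with \<open>e \<cdot> e = e\<close>, \<open>M = k u\<close>, all products with \<open>u\<close>
  equal to \<open>0\<close> in \<open>A \<oplus> M\<close>, \<open>N e = e\<close>, \<open>N u = u\<close>, and \<open>e \<mapsto> e + u\<close>, \<open>u \<mapsto> u\<close> on
  \<open>A \<oplus> M\<close>. For the obvious section \<open>psi = 0\<close> and \<open>chi e = u\<close>, and the sum of the other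
  five summands of \<open>partial1\<close> at \<open>chi\<close> is \<open>- chi (N e \<cdot> e + e \<cdot> N e - N (e \<cdot> e)) = - u\<close>.)
  The summand has no influence on \<open>d1\<close>, hence none on which cochains differ by a coboundary.
\<close>

definition partial1 ::
    "('k, 'w::semigroup_mult, 'a::ab_group_add) family_alg \<Rightarrow> ('k, 'w, 'm) family_alg \<Rightarrow>
     ('w, 'a, 'm::ab_group_add) lact \<Rightarrow> ('w, 'a, 'm) ract \<Rightarrow>
     ('w \<Rightarrow> 'a \<Rightarrow> 'm) \<Rightarrow> 'w \<Rightarrow> 'w \<Rightarrow> 'a \<Rightarrow> 'a \<Rightarrow> 'm" where
  "partial1 A M l r g \<alpha> \<beta> a b =
     l \<alpha> \<beta> (nij A \<alpha> a) (g \<beta> b) - nij M (\<alpha> * \<beta>) (l \<alpha> \<beta> a (g \<beta> b))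
     - g (\<alpha> * \<beta>)
         (mul A \<alpha> \<beta> (nij A \<alpha> a) b + mul A \<alpha> \<beta> a (nij A \<beta> b) - nij A (\<alpha> * \<beta>) (mul A \<alpha> \<beta> a b))
     + r \<alpha> \<beta> (g \<alpha> a) (nij A \<beta> b) - nij M (\<alpha> * \<beta>) (r \<alpha> \<beta> (g \<alpha> a) b)
     + nij M (\<alpha> * \<beta>) (g (\<alpha> * \<beta>) (mul A \<alpha> \<beta> a b))"

definition Phi1 ::
    "('k, 'w, 'a) family_alg \<Rightarrow> ('k, 'w, 'm::ab_group_add) family_alg \<Rightarrow>
     ('w \<Rightarrow> 'a \<Rightarrow> 'm) \<Rightarrow> 'w \<Rightarrow> 'a \<Rightarrow> 'm" where
  "Phi1 A M f \<alpha> a = f \<alpha> (nij A \<alpha> a) - nij M \<alpha> (f \<alpha> a)"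

definition Phi2 ::
    "('k, 'w::semigroup_mult, 'a) family_alg \<Rightarrow> ('k, 'w, 'm::ab_group_add) family_alg \<Rightarrow>
     ('w \<Rightarrow> 'w \<Rightarrow> 'a \<Rightarrow> 'a \<Rightarrow> 'm) \<Rightarrow> 'w \<Rightarrow> 'w \<Rightarrow> 'a \<Rightarrow> 'a \<Rightarrow> 'm" where
  "Phi2 A M f \<alpha> \<beta> a b =
     f \<alpha> \<beta> (nij A \<alpha> a) (nij A \<beta> b)
     - nij M (\<alpha> * \<beta>) (f \<alpha> \<beta> (nij A \<alpha> a) b) - nij M (\<alpha> * \<beta>) (f \<alpha> \<beta> a (nij A \<beta> b))
     + nij M (\<alpha> * \<beta>) (nij M (\<alpha> * \<beta>) (f \<alpha> \<beta> a b))"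

definition d1 ::
    "('k, 'w::monoid_mult, 'a) family_alg \<Rightarrow> ('k, 'w, 'm::ab_group_add) family_alg \<Rightarrow>
     ('w, 'a, 'm) lact \<Rightarrow> ('w, 'a, 'm) ract \<Rightarrow> ('w, 'a, 'm) cochain1 \<Rightarrow> ('w, 'a, 'm) cochain2" where
  "d1 A M l r = (\<lambda>(f, m). (delta1 A l r f, - partial0 A M l r m - Phi1 A M f))"

definition d2 ::
    "('k, 'w::monoid_mult, 'a::ab_group_add) family_alg \<Rightarrow>
     ('k, 'w, 'm::ab_group_add) family_alg \<Rightarrow> ('w, 'a, 'm) lact \<Rightarrow> ('w, 'a, 'm) ract \<Rightarrow>
     ('w, 'a, 'm) cochain2 \<Rightarrow>
     ('w \<Rightarrow> 'w \<Rightarrow> 'w \<Rightarrow> 'a \<Rightarrow> 'a \<Rightarrow> 'a \<Rightarrow> 'm) \<times> ('w \<Rightarrow> 'w \<Rightarrow> 'a \<Rightarrow> 'a \<Rightarrow> 'm)" where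
  "d2 A M l r = (\<lambda>(f, g). (delta2 A l r f, - partial1 A M l r g - Phi2 A M f))"

definition Z2 ::
    "('k::field, 'w::monoid_mult, 'a::ab_group_add) family_alg \<Rightarrow>
     ('k, 'w, 'm::ab_group_add) family_alg \<Rightarrow> ('w, 'a, 'm) lact \<Rightarrow> ('w, 'a, 'm) ract \<Rightarrow>
     ('w, 'a, 'm) cochain2 set" where
  "Z2 A M l r = {c \<in> C2 A M. d2 A M l r c = 0}"

definition B2 ::
    "('k::field, 'w::monoid_mult, 'a::ab_group_add) family_alg \<Rightarrow>
     ('k, 'w, 'm::ab_group_add) family_alg \<Rightarrow> ('w, 'a, 'm) lact \<Rightarrow> ('w, 'a, 'm) ract \<Rightarrow>
     ('w, 'a, 'm) cochain2 set" where
  "B2 A M l r = d1 A M l r ` C1 A M"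

definition cohomologous ::
    "('k::field, 'w::monoid_mult, 'a::ab_group_add) family_alg \<Rightarrow>
     ('k, 'w, 'm::ab_group_add) family_alg \<Rightarrow> ('w, 'a, 'm) lact \<Rightarrow> ('w, 'a, 'm) ract \<Rightarrow>
     ('w, 'a, 'm) cochain2 rel" where
  "cohomologous A M l r =
     {(c, c'). c \<in> Z2 A M l r \<and> c' \<in> Z2 A M l r \<and> c - c' \<in> B2 A M l r}"

definition H2 ::
    "('k::field, 'w::monoid_mult, 'a::ab_group_add) family_alg \<Rightarrow>
     ('k, 'w, 'm::ab_group_add) family_alg \<Rightarrow> ('w, 'a, 'm) lact \<Rightarrow> ('w, 'a, 'm) ract \<Rightarrow>
     ('w, 'a, 'm) cochain2 set set" where
  "H2 A M l r = Z2 A M l r // cohomologous A M l r"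

definition extension_class ::
    "('k::field, 'w::monoid_mult, 'a::ab_group_add) family_alg \<Rightarrow>
     ('k, 'w, 'm::ab_group_add) family_alg \<Rightarrow>
     ('k, 'w, 'm, 'e::ab_group_add, 'a) extension \<Rightarrow> ('w \<Rightarrow> 'a \<Rightarrow> 'e) \<Rightarrow>
     ('w, 'a, 'm) cochain2 set" where
  "extension_class A M E s =
     cohomologous A M (left_action A E) (right_action A E) `` {(psi A E s, chi A E s)}"

end

theory Submission imports Defs begin

text \<open>
  An isomorphism \<open>\<zeta>\<close> of extensions carries a family of sections \<open>s\<close> of \<open>E1\<close> to the family
  \<open>\<zeta> \<circ> s\<close> of sections of \<open>E2\<close> with the same actions and the same pair \<open>(psi, chi)\<close>, so it
  suffices to vary the sections within one extension. If \<open>s\<close> and \<open>t\<close> are families of sections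
  of \<open>E\<close>, then \<open>s - t\<close> takes values in the kernel of the projection, hence equals \<open>incl E \<circ> f\<close>
  for a linear family \<open>f\<close>, and as products of elements of \<open>M\<close> vanish, the two pairs differ
  by \<open>d1 (f, 0)\<close>. All identities in \<open>M\<close> are verified after applying the injective \<open>incl E\<close>.
\<close>

section \<open>Linear and bilinear maps, and the axioms as rules\<close>

lemma linearI:
  assumes "vector_space sa" "vector_space sb"
    and "\<And>x y. f (x + y) = f x + f y" "\<And>c x. f (sa c x) = sb c (f x)"
  shows "Vector_Spaces.linear sa sb f"
  using assms unfolding Vector_Spaces.linear_iff by blast

lemma linear_simps:
  assumes "Vector_Spaces.linear sa sb f"
  shows "f (x + y) = f x + f y" "f (x - y) = f x - f y" "f (- x) = - f x" "f 0 = 0"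
    and "f (sa c x) = sb c (f x)"
proof -
  interpret Vector_Spaces.linear sa sb f by fact
  show "f (x + y) = f x + f y" "f (x - y) = f x - f y" "f (- x) = - f x" "f 0 = 0"
    "f (sa c x) = sb c (f x)"
    by (simp_all add: add diff neg zero scale)
qed

lemma linear_vector_space:
  assumes "Vector_Spaces.linear sa sb f"
  shows "vector_space sa" "vector_space sb"
  using assms unfolding Vector_Spaces.linear_iff by blast+

lemma linear_diff:
  assumes f: "Vector_Spaces.linear sa sb f" and g: "Vector_Spaces.linear sa sb g"
  shows "Vector_Spaces.linear sa sb (f - g)"
proof -
  interpret vector_space sb by (rule linear_vector_space(2)[OF f])
  show ?thesis
    by (rule linearI) (simp_all add: linear_vector_space[OF f]
        linear_simps[OF f] linear_simps[OF g] scale_right_diff_distrib)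
qed

lemma bilinear_mapI:
  assumes "vector_space sa" "vector_space sb" "vector_space sc"
    and "\<And>a x y. h a (x + y) = h a x + h a y" "\<And>c a x. h a (sb c x) = sc c (h a x)"
    and "\<And>a x y. h (x + y) a = h x a + h y a" "\<And>c a x. h (sa c x) a = sc c (h x a)"
  shows "bilinear_map sa sb sc h"
  unfolding bilinear_map_def by (intro conjI allI linearI assms)

lemma bilinear_map_simps:
  assumes "bilinear_map sa sb sc h"
  shows "h a (x + y) = h a x + h a y" "h a (x - y) = h a x - h a y"
    "h a (- x) = - h a x" "h a 0 = 0" "h a (sb c x) = sc c (h a x)"
    "h (u + v) b = h u b + h v b" "h (u - v) b = h u b - h v b"
    "h (- u) b = - h u b" "h 0 b = 0" "h (sa c u) b = sc c (h u b)"
proof -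
  have l: "Vector_Spaces.linear sb sc (h a)" "Vector_Spaces.linear sa sc (\<lambda>a. h a b)" for a b
    using assms unfolding bilinear_map_def by blast+
  show "h a (x + y) = h a x + h a y" "h a (x - y) = h a x - h a y"
    "h a (- x) = - h a x" "h a 0 = 0" "h a (sb c x) = sc c (h a x)"
    by (rule linear_simps[OF l(1)])+
  show "h (u + v) b = h u b + h v b" "h (u - v) b = h u b - h v b"
    "h (- u) b = - h u b" "h 0 b = 0" "h (sa c u) b = sc c (h u b)"
    by (rule linear_simps[OF l(2)])+
qed

lemma nijenhuis_family_algebraD:
  assumes "nijenhuis_family_algebra A"
  shows "vector_space (smul A)"
    and "bilinear_map (smul A) (smul A) (smul A) (mul A \<alpha> \<beta>)"
    and "mul A (\<alpha> * \<beta>) \<gamma> (mul A \<alpha> \<beta> a b) c = mul A \<alpha> (\<beta> * \<gamma>) a (mul A \<beta> \<gamma> b c)"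
    and "Vector_Spaces.linear (smul A) (smul A) (nij A \<omega>)"
    and "mul A \<alpha> \<beta> (nij A \<alpha> a) (nij A \<beta> b) =
        nij A (\<alpha> * \<beta>)
          (mul A \<alpha> \<beta> (nij A \<alpha> a) b + mul A \<alpha> \<beta> a (nij A \<beta> b)
           - nij A (\<alpha> * \<beta>) (mul A \<alpha> \<beta> a b))"
  using assms unfolding nijenhuis_family_algebra_def omega_associative_algebra_def by blast+

lemma nfa_morphismD:
  assumes "nfa_morphism A B f"
  shows "Vector_Spaces.linear (smul A) (smul B) (f \<omega>)"
    and "f \<omega> (nij A \<omega> x) = nij B \<omega> (f \<omega> x)"
    and "f (\<alpha> * \<beta>) (mul A \<alpha> \<beta> a b) = mul B \<alpha> \<beta> (f \<alpha> a) (f \<beta> b)"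
  using assms unfolding nfa_morphism_def by (auto simp: fun_eq_iff)

text \<open>For arbitrary \<open>l\<close> and \<open>r\<close> the coboundaries need not form a
  subgroup, so this is assumed as 0 and closure under differences. Symmetry is 0 - (c - c'), and
  transitivity is (x - y) - (0 - (y - z)).\<close>

lemma equiv_cohomologous:
  assumes zero: "0 \<in> B2 A M l r"
    and diff: "\<And>c c'. c \<in> B2 A M l r \<Longrightarrow> c' \<in> B2 A M l r \<Longrightarrow> c - c' \<in> B2 A M l r"
  shows "equiv (Z2 A M l r) (cohomologous A M l r)"
proof (rule equivI)
  show "refl_on (Z2 A M l r) (cohomologous A M l r)"
    using zero by (auto simp: refl_on_def cohomologous_def)
  show "cohomologous A M l r \<subseteq> Z2 A M l r \<times> Z2 A M l r"
    by (auto simp: cohomologous_def)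
  show "sym (cohomologous A M l r)"
  proof (rule symI)
    fix c c' assume "(c, c') \<in> cohomologous A M l r"
    then show "(c', c) \<in> cohomologous A M l r"
      using diff[OF zero, of "c - c'"] by (simp add: cohomologous_def)
  qed
  show "trans (cohomologous A M l r)"
  proof (rule transI)
    fix x y z assume xy: "(x, y) \<in> cohomologous A M l r" and yz: "(y, z) \<in> cohomologous A M l r"
    have "x - y \<in> B2 A M l r" "y - z \<in> B2 A M l r"
      using xy yz by (simp_all add: cohomologous_def)
    then have "(x - y) - (0 - (y - z)) \<in> B2 A M l r"
      by (rule diff[OF _ diff[OF zero]])
    then show "(x, z) \<in> cohomologous A M l r"
      using xy yz by (simp add: cohomologous_def)
  qed
qed

section \<open>One abelian extension with a chosen family of sections\<close>

locale split_extension =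
  fixes A :: "('k::field, 'w::monoid_mult, 'a::ab_group_add) family_alg"
    and M :: "('k, 'w, 'm::ab_group_add) family_alg"
    and E :: "('k, 'w, 'm, 'e::ab_group_add, 'a) extension"
    and s :: "'w \<Rightarrow> 'a \<Rightarrow> 'e"
  assumes abelian_extension: "abelian_extension A M E"
    and section_family: "section_family A E s"
begin

abbreviation "l \<equiv> left_action A E"
abbreviation "r \<equiv> right_action A E"

lemma extension_algebras:
  "nijenhuis_family_algebra A" "nijenhuis_family_algebra M" "nijenhuis_family_algebra (total E)"
  and extension_morphisms: "nfa_morphism M (total E) (incl E)" "nfa_morphism (total E) A (proj E)"
  using abelian_extension unfolding abelian_extension_def by blast+

lemma mul_M [simp]: "mul M \<alpha> \<beta> x y = 0"
  using abelian_extension unfolding abelian_extension_def by blast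

lemma linear_s: "Vector_Spaces.linear (smul A) (smul (total E)) (s \<omega>)"
  using section_family unfolding section_family_def by blast

lemma proj_section: "section_family A E t \<Longrightarrow> proj E \<omega> (t \<omega> a) = a"
  unfolding section_family_def by (auto simp: fun_eq_iff)

lemma incl_inject [simp]: "incl E \<omega> x = incl E \<omega> y \<longleftrightarrow> x = y"
  using abelian_extension unfolding abelian_extension_def by (meson injD)

lemma ker_proj: "proj E \<omega> x = 0 \<Longrightarrow> \<exists>m. x = incl E \<omega> m"
  using abelian_extension unfolding abelian_extension_def by blast

lemmas vector_spaces [simp] = extension_algebras[THEN nijenhuis_family_algebraD(1)]
lemmas incl_mul = extension_morphisms(1)[THEN nfa_morphismD(3)]
lemmas proj_mul [simp] = extension_morphisms(2)[THEN nfa_morphismD(3)]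
lemmas incl_nij = extension_morphisms(1)[THEN nfa_morphismD(2)]
lemmas proj_nij [simp] = extension_morphisms(2)[THEN nfa_morphismD(2)]
lemmas total_assoc = extension_algebras(3)[THEN nijenhuis_family_algebraD(3)]
lemmas incl_simps = linear_simps[OF extension_morphisms(1)[THEN nfa_morphismD(1)]]
lemmas proj_simps = linear_simps[OF extension_morphisms(2)[THEN nfa_morphismD(1)]]
lemmas s_simps = linear_simps[OF linear_s]
lemmas mul_simps =
  bilinear_map_simps[OF extension_algebras(1)[THEN nijenhuis_family_algebraD(2)]]
  bilinear_map_simps[OF extension_algebras(3)[THEN nijenhuis_family_algebraD(2)]]
lemmas nij_simps =
  linear_simps[OF extension_algebras(1)[THEN nijenhuis_family_algebraD(4)]]
  linear_simps[OF extension_algebras(2)[THEN nijenhuis_family_algebraD(4)]]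
  linear_simps[OF extension_algebras(3)[THEN nijenhuis_family_algebraD(4)]]
lemmas smul_simps =
  vector_space.vector_space_assms(1)[OF vector_spaces(2)]
  vector_space.vector_space_assms(1)[OF vector_spaces(3)]
  module.scale_right_diff_distrib[OF vector_spaces(2)[unfolded module_iff_vector_space[symmetric]]]
  module.scale_right_diff_distrib[OF vector_spaces(3)[unfolded module_iff_vector_space[symmetric]]]
lemmas hom_simps = incl_simps proj_simps s_simps mul_simps nij_simps

lemma proj_s [simp]: "proj E \<omega> (s \<omega> a) = a"
  by (rule proj_section[OF section_family])

lemma proj_incl [simp]: "proj E \<omega> (incl E \<omega> m) = 0"
  using abelian_extension unfolding abelian_extension_def by blast

text \<open>The inclusion is multiplicative and products in \<open>M\<close> vanish. This is what
  removes every term quadratic in \<open>M\<close> below.\<close>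

lemma mul_incl_incl [simp]: "mul (total E) \<alpha> \<beta> (incl E \<alpha> m) (incl E \<beta> n) = 0"
  using incl_mul[of \<alpha> \<beta> m n] by (simp add: hom_simps)

text \<open>Both sections are right inverses of the projection, so their difference lies in its
  kernel, which is the image of \<open>M\<close>.\<close>

lemma section_diff:
  assumes "section_family A E t"
  obtains m where "t \<omega> a = s \<omega> a + incl E \<omega> m"
proof -
  have "proj E \<omega> (t \<omega> a - s \<omega> a) = 0"
    by (simp add: hom_simps proj_section[OF assms])
  then obtain m where "t \<omega> a - s \<omega> a = incl E \<omega> m" using ker_proj by blast
  then show thesis by (intro that[of m]) (simp add: algebra_simps)
qed

section \<open>The induced actions and the pair \<open>(psi, chi)\<close> seen in
  \<open>total E\<close>\<close>

text \<open>Another section changes the left factor by an element of \<open>M\<close>, whose product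
  with \<open>incl E \<beta> m\<close> is 0. The product itself projects to 0, so exactness gives a
  preimage.\<close>

lemma incl_left_action:
  "incl E (\<alpha> * \<beta>) (l \<alpha> \<beta> a m) = mul (total E) \<alpha> \<beta> (s \<alpha> a) (incl E \<beta> m)"
proof -
  have indep: "mul (total E) \<alpha> \<beta> (t \<alpha> a) (incl E \<beta> m) = mul (total E) \<alpha> \<beta> (s \<alpha> a) (incl E \<beta> m)"
    if t: "section_family A E t" for t
    by (rule section_diff[OF t, of \<alpha> a]) (simp add: hom_simps)
  have "proj E (\<alpha> * \<beta>) (mul (total E) \<alpha> \<beta> (s \<alpha> a) (incl E \<beta> m)) = 0"
    by (simp add: hom_simps)
  then obtain x where x: "mul (total E) \<alpha> \<beta> (s \<alpha> a) (incl E \<beta> m) = incl E (\<alpha> * \<beta>) x"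
    using ker_proj by blast
  have "l \<alpha> \<beta> a m = x"
    unfolding left_action_def
  proof (rule the_equality)
    show "\<forall>t. section_family A E t \<longrightarrow>
        incl E (\<alpha> * \<beta>) x = mul (total E) \<alpha> \<beta> (t \<alpha> a) (incl E \<beta> m)"
      using indep x by simp
  next
    fix y assume "\<forall>t. section_family A E t \<longrightarrow>
        incl E (\<alpha> * \<beta>) y = mul (total E) \<alpha> \<beta> (t \<alpha> a) (incl E \<beta> m)"
    \<comment> \<open>Instantiate at the fixed section \<open>s\<close>: its existence keeps the
      universally quantified condition from being vacuous.\<close>
    then show "y = x" using section_family x by (metis incl_inject)
  qed
  then show ?thesis using x by simp
qed

lemma incl_right_action:
  "incl E (\<alpha> * \<beta>) (r \<alpha> \<beta> m a) = mul (total E) \<alpha> \<beta> (incl E \<alpha> m) (s \<beta> a)"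
proof -
  have indep: "mul (total E) \<alpha> \<beta> (incl E \<alpha> m) (t \<beta> a) = mul (total E) \<alpha> \<beta> (incl E \<alpha> m) (s \<beta> a)"
    if t: "section_family A E t" for t
    by (rule section_diff[OF t, of \<beta> a]) (simp add: hom_simps)
  have "proj E (\<alpha> * \<beta>) (mul (total E) \<alpha> \<beta> (incl E \<alpha> m) (s \<beta> a)) = 0"
    by (simp add: hom_simps)
  then obtain x where x: "mul (total E) \<alpha> \<beta> (incl E \<alpha> m) (s \<beta> a) = incl E (\<alpha> * \<beta>) x"
    using ker_proj by blast
  have "r \<alpha> \<beta> m a = x"
    unfolding right_action_def
  proof (rule the_equality)
    show "\<forall>t. section_family A E t \<longrightarrow>
        incl E (\<alpha> * \<beta>) x = mul (total E) \<alpha> \<beta> (incl E \<alpha> m) (t \<beta> a)"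
      using indep x by simp
  next
    fix y assume "\<forall>t. section_family A E t \<longrightarrow>
        incl E (\<alpha> * \<beta>) y = mul (total E) \<alpha> \<beta> (incl E \<alpha> m) (t \<beta> a)"
    then show "y = x" using section_family x by (metis incl_inject)
  qed
  then show ?thesis using x by simp
qed

text \<open>The chosen inverse \<open>inv\<close> is a right inverse only on the range, which by
  exactness is the kernel of the projection.\<close>

lemma incl_inv: "proj E \<omega> x = 0 \<Longrightarrow> incl E \<omega> (inv (incl E \<omega>) x) = x"
  using f_inv_into_f[of x "incl E \<omega>" UNIV] ker_proj by blast

lemma incl_psi: "incl E (\<alpha> * \<beta>) (psi A E s \<alpha> \<beta> a b) =
    mul (total E) \<alpha> \<beta> (s \<alpha> a) (s \<beta> b) - s (\<alpha> * \<beta>) (mul A \<alpha> \<beta> a b)"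
  unfolding psi_def by (rule incl_inv) (simp add: hom_simps)

lemma incl_chi: "incl E \<omega> (chi A E s \<omega> a) = nij (total E) \<omega> (s \<omega> a) - s \<omega> (nij A \<omega> a)"
  unfolding chi_def by (rule incl_inv) (simp add: hom_simps)

lemma bilinear_psi: "bilinear_map (smul A) (smul A) (smul M) (psi A E s \<alpha> \<beta>)"
  by (rule bilinear_mapI; (subst incl_inject[where \<omega> = "\<alpha> * \<beta>", symmetric])?;
      simp add: incl_psi hom_simps smul_simps)

lemma linear_chi: "Vector_Spaces.linear (smul A) (smul M) (chi A E s \<alpha>)"
  by (rule linearI; (subst incl_inject[where \<omega> = \<alpha>, symmetric])?;
      simp add: incl_chi hom_simps smul_simps)

lemma left_action_simps:
  "l \<alpha> \<beta> a 0 = 0" "l \<alpha> \<beta> a (m - n) = l \<alpha> \<beta> a m - l \<alpha> \<beta> a n"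
  by (subst incl_inject[where \<omega> = "\<alpha> * \<beta>", symmetric], simp add: incl_left_action hom_simps)+

lemma right_action_simps:
  "r \<alpha> \<beta> 0 a = 0" "r \<alpha> \<beta> (m - n) a = r \<alpha> \<beta> m a - r \<alpha> \<beta> n a"
  by (subst incl_inject[where \<omega> = "\<alpha> * \<beta>", symmetric], simp add: incl_right_action hom_simps)+

section \<open>The cocycle conditions\<close>

text \<open>In \<open>total E\<close> the summands expand to the two bracketings of the product of
  \<open>s \<alpha> a\<close>, \<open>s \<beta> b\<close>, \<open>s \<gamma> c\<close>, the two
  values of \<open>s\<close> at the triple product in \<open>A\<close>, and mixed terms that cancel.
  Associativity in \<open>total E\<close> and in \<open>A\<close> settles the rest.\<close>

lemma delta2_psi: "delta2 A l r (psi A E s) \<alpha> \<beta> \<gamma> a b c = 0"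
proof -
  \<comment> \<open>The summands carry differently bracketed indices; all are brought to the left
    bracketing so that they can be compared.\<close>
  have assoc: "incl E (\<alpha> * (\<beta> * \<gamma>)) = incl E ((\<alpha> * \<beta>) * \<gamma>)" "s (\<alpha> * (\<beta> * \<gamma>)) = s ((\<alpha> * \<beta>) * \<gamma>)"
    by (simp_all add: mult.assoc)
  have "incl E ((\<alpha> * \<beta>) * \<gamma>) (delta2 A l r (psi A E s) \<alpha> \<beta> \<gamma> a b c) = 0"
    unfolding delta2_def incl_simps
      incl_left_action[of \<alpha> "\<beta> * \<gamma>", unfolded assoc] incl_psi[of \<alpha> "\<beta> * \<gamma>", unfolded assoc]
      incl_right_action incl_psi
    by (simp add: hom_simps total_assoc extension_algebras(1)[THEN nijenhuis_family_algebraD(3)])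
  then show ?thesis by (metis incl_simps(4) incl_inject)
qed

text \<open>The sum is the negative of the second component of \<open>d2\<close> at
  \<open>(psi, chi)\<close>. It vanishes by the Nijenhuis identities of \<open>total E\<close> and
  \<open>A\<close>, together with the vanishing product of two values of \<open>chi\<close>.\<close>

lemma partial1_chi: "partial1 A M l r (chi A E s) \<alpha> \<beta> a b + Phi2 A M (psi A E s) \<alpha> \<beta> a b = 0"
proof -
  note N = nijenhuis_family_algebraD(5)[OF extension_algebras(3), of \<alpha> \<beta> "s \<alpha> a" "s \<beta> b"]
  have "mul (total E) \<alpha> \<beta> (nij (total E) \<alpha> (s \<alpha> a) - s \<alpha> (nij A \<alpha> a))
      (nij (total E) \<beta> (s \<beta> b) - s \<beta> (nij A \<beta> b)) = 0"
    unfolding incl_chi[symmetric] by (rule mul_incl_incl)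
  \<comment> \<open>The vanishing product is solved for the mixed term that \<open>r\<close>
    contributes to \<open>partial1\<close>; the product of two Nijenhuis images on the right is then
    handled by \<open>N\<close>.\<close>
  then have chi_chi: "mul (total E) \<alpha> \<beta> (nij (total E) \<alpha> (s \<alpha> a)) (s \<beta> (nij A \<beta> b)) =
      mul (total E) \<alpha> \<beta> (nij (total E) \<alpha> (s \<alpha> a)) (nij (total E) \<beta> (s \<beta> b))
      - mul (total E) \<alpha> \<beta> (s \<alpha> (nij A \<alpha> a)) (nij (total E) \<beta> (s \<beta> b))
      + mul (total E) \<alpha> \<beta> (s \<alpha> (nij A \<alpha> a)) (s \<beta> (nij A \<beta> b))"
    by (simp add: mul_simps algebra_simps)
  \<comment> \<open>This turns the term of \<open>Phi2\<close> in which \<open>s\<close> is applied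
    to a product of Nijenhuis images in \<open>A\<close> into one that cancels against the
    \<open>chi\<close> summand of \<open>partial1\<close>.\<close>
  note NA = nijenhuis_family_algebraD(5)[OF extension_algebras(1), of \<alpha> \<beta> a b]
  have "incl E (\<alpha> * \<beta>) (partial1 A M l r (chi A E s) \<alpha> \<beta> a b + Phi2 A M (psi A E s) \<alpha> \<beta> a b) = 0"
    unfolding partial1_def Phi2_def incl_simps incl_left_action incl_right_action incl_psi incl_chi
      incl_nij NA
    by (simp add: hom_simps chi_chi N)
  then show ?thesis by (metis incl_simps(4) incl_inject)
qed

lemma psi_chi_cocycle: "(psi A E s, chi A E s) \<in> Z2 A M l r"
proof -
  have "- partial1 A M l r (chi A E s) - Phi2 A M (psi A E s) = 0"
    using partial1_chi by (simp add: fun_eq_iff) (metis add_eq_0_iff)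
  moreover have "delta2 A l r (psi A E s) = 0"
    by (simp add: fun_eq_iff delta2_psi)
  ultimately show ?thesis
    by (simp add: Z2_def C2_def d2_def bilinear_psi linear_chi zero_prod_def)
qed

section \<open>Coboundaries and the class of the extension\<close>

lemma d1_diff: "d1 A M l r (x - y) = d1 A M l r x - d1 A M l r y"
  by (cases x; cases y)
    (simp add: d1_def fun_eq_iff delta1_def partial0_def Phi1_def left_action_simps
      right_action_simps hom_simps)

lemma equiv_Z2: "equiv (Z2 A M l r) (cohomologous A M l r)"
proof (rule equiv_cohomologous)
  have C1_diff: "x - y \<in> C1 A M" if "x \<in> C1 A M" "y \<in> C1 A M" for x y
    using that by (auto simp: C1_def linear_diff)
  show diff: "c - c' \<in> B2 A M l r" if c: "c \<in> B2 A M l r" "c' \<in> B2 A M l r" for c c'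
  proof -
    from c obtain x y where "x \<in> C1 A M" "c = d1 A M l r x" "y \<in> C1 A M" "c' = d1 A M l r y"
      unfolding B2_def by blast
    then show ?thesis
      unfolding B2_def by (auto simp: d1_diff[symmetric] intro: C1_diff)
  qed
  \<comment> \<open>A linear family already at hand shows that \<open>C1 A M\<close> is inhabited;
    its coboundary minus itself is 0.\<close>
  have "(chi A E s, 0) \<in> C1 A M"
    by (simp add: C1_def linear_chi)
  then have "d1 A M l r (chi A E s, 0) \<in> B2 A M l r" unfolding B2_def by blast
  from diff[OF this this] show "0 \<in> B2 A M l r" by simp
qed

lemma class_in_H2: "extension_class A M E s \<in> H2 A M l r"
  unfolding extension_class_def H2_def by (rule quotientI[OF psi_chi_cocycle])

section \<open>Independence of the sections\<close>

lemma extension_class_section: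
  assumes t: "section_family A E t"
  shows "extension_class A M E s = extension_class A M E t"
proof -
  \<comment> \<open>The actions do not mention the sections, so \<open>l\<close> and
    \<open>r\<close> are shared and may be computed with \<open>t\<close> as well as with
    \<open>s\<close>.\<close>
  interpret t: split_extension A M E t
    by unfold_locales (fact abelian_extension t)+
  have "\<exists>m. s \<omega> a = t \<omega> a + incl E \<omega> m" for \<omega> a
    by (rule t.section_diff[OF section_family]) blast
  then obtain f where f: "\<And>\<omega> a. s \<omega> a = t \<omega> a + incl E \<omega> (f \<omega> a)" by metis
  have if_eq: "incl E \<omega> (f \<omega> a) = s \<omega> a - t \<omega> a" for \<omega> a by (simp add: f)
  have "Vector_Spaces.linear (smul A) (smul M) (f \<omega>)" for \<omega>
    by (rule linearI; (subst incl_inject[where \<omega> = \<omega>, symmetric])?;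
      simp add: if_eq hom_simps t.s_simps smul_simps)
  then have C1: "(f, 0) \<in> C1 A M" by (simp add: C1_def)
  \<comment> \<open>Expanding the product at \<open>s\<close> = \<open>t\<close> +
    \<open>incl E\<close> after \<open>f\<close>, the two mixed terms are the actions on
    \<open>f\<close> and the quadratic term vanishes.\<close>
  have "psi A E s \<alpha> \<beta> a b - psi A E t \<alpha> \<beta> a b = delta1 A l r f \<alpha> \<beta> a b" for \<alpha> \<beta> a b
    by (subst incl_inject[where \<omega> = "\<alpha> * \<beta>", symmetric])
      (simp add: delta1_def incl_simps incl_psi t.incl_psi t.incl_left_action
        t.incl_right_action f mul_simps)
  \<comment> \<open>The inclusion commutes with the Nijenhuis maps, so the difference is
    \<open>nij M\<close> after \<open>f\<close> minus \<open>f\<close> after \<open>nij A\<close>;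
    this fixes the sign.\<close>
  moreover have "chi A E s \<omega> a - chi A E t \<omega> a = - Phi1 A M f \<omega> a" for \<omega> a
    by (subst incl_inject[where \<omega> = "\<omega>", symmetric])
      (simp add: Phi1_def incl_simps incl_chi t.incl_chi incl_nij if_eq nij_simps)
  \<comment> \<open>With second entry 0 the term \<open>partial0\<close> vanishes, leaving just
    \<open>- Phi1\<close>.\<close>
  ultimately have "(psi A E s, chi A E s) - (psi A E t, chi A E t) = d1 A M l r (f, 0)"
    by (simp add: d1_def fun_eq_iff partial0_def left_action_simps right_action_simps nij_simps)
  then have "((psi A E s, chi A E s), (psi A E t, chi A E t)) \<in> cohomologous A M l r"
    using psi_chi_cocycle t.psi_chi_cocycle C1 by (auto simp: cohomologous_def B2_def)
  then show ?thesis
    unfolding extension_class_def by (rule equiv_class_eq[OF equiv_Z2])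
qed

end

section \<open>Transport along an isomorphism of extensions\<close>

theorem proposition5p6:
  fixes A :: "('k::field, 'w::monoid_mult, 'a::ab_group_add) family_alg"
    and M :: "('k, 'w, 'm::ab_group_add) family_alg"
    and E1 :: "('k, 'w, 'm, 'e1::ab_group_add, 'a) extension"
    and E2 :: "('k, 'w, 'm, 'e2::ab_group_add, 'a) extension"
    and s1 :: "'w \<Rightarrow> 'a \<Rightarrow> 'e1" and s2 :: "'w \<Rightarrow> 'a \<Rightarrow> 'e2"
  assumes "nijenhuis_family_algebra A"
    and "abelian_extension A M E1" and "abelian_extension A M E2"
    and "isomorphic_extensions E1 E2"
    and "section_family A E1 s1" and "section_family A E2 s2"
  shows "left_action A E1 = left_action A E2 \<and> right_action A E1 = right_action A E2 \<and>
    extension_class A M E1 s1 \<in> H2 A M (left_action A E1) (right_action A E1) \<and>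
    extension_class A M E1 s1 = extension_class A M E2 s2"
proof -
  obtain \<zeta> where \<zeta>: "nfa_morphism (total E1) (total E2) \<zeta>"
    and "\<And>\<omega>. \<zeta> \<omega> \<circ> incl E1 \<omega> = incl E2 \<omega>" "\<And>\<omega>. proj E2 \<omega> \<circ> \<zeta> \<omega> = proj E1 \<omega>"
    using assms(4) unfolding isomorphic_extensions_def nfa_isomorphism_def by auto
  then have \<zeta>_incl: "\<zeta> \<omega> (incl E1 \<omega> m) = incl E2 \<omega> m"
    and \<zeta>_proj: "proj E2 \<omega> (\<zeta> \<omega> x) = proj E1 \<omega> x" for \<omega> m x
    by (auto simp: fun_eq_iff)
  interpret E1: split_extension A M E1 s1
    by unfold_locales fact+
  define t where "t = (\<lambda>\<omega> a. \<zeta> \<omega> (s1 \<omega> a))"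
  note \<zeta>_simps = linear_simps[OF nfa_morphismD(1)[OF \<zeta>]]
  note \<zeta>_mul = nfa_morphismD(3)[OF \<zeta>]
  have t: "section_family A E2 t"
    unfolding section_family_def
  proof (intro allI conjI)
    show "Vector_Spaces.linear (smul A) (smul (total E2)) (t \<omega>)" for \<omega>
      by (rule linearI) (auto simp: t_def E1.s_simps \<zeta>_simps
          linear_vector_space[OF nfa_morphismD(1)[OF \<zeta>]])
    show "proj E2 \<omega> \<circ> t \<omega> = id" for \<omega>
      by (simp add: fun_eq_iff t_def \<zeta>_proj)
  qed
  interpret E2: split_extension A M E2 t
    by unfold_locales fact+
  \<comment> \<open>The first simplification pulls the equation back to \<open>total E1\<close> and
    pushes the product through \<zeta>; the second returns to \<open>incl E2\<close>, where the
    action is a product with \<open>t\<close>.\<close>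
  have l: "left_action A E1 \<alpha> \<beta> a m = left_action A E2 \<alpha> \<beta> a m" for \<alpha> \<beta> a m
    by (subst E2.incl_inject[where \<omega> = "\<alpha> * \<beta>", symmetric])
      (simp add: \<zeta>_incl[symmetric] E1.incl_left_action \<zeta>_mul,
       simp add: \<zeta>_incl E2.incl_left_action t_def)
  have r: "right_action A E1 \<alpha> \<beta> m a = right_action A E2 \<alpha> \<beta> m a" for \<alpha> \<beta> a m
    by (subst E2.incl_inject[where \<omega> = "\<alpha> * \<beta>", symmetric])
      (simp add: \<zeta>_incl[symmetric] E1.incl_right_action \<zeta>_mul,
       simp add: \<zeta>_incl E2.incl_right_action t_def)
  have psi: "psi A E1 s1 \<alpha> \<beta> a b = psi A E2 t \<alpha> \<beta> a b" for \<alpha> \<beta> a b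
  proof -
    have "incl E2 (\<alpha> * \<beta>) (psi A E1 s1 \<alpha> \<beta> a b) = incl E2 (\<alpha> * \<beta>) (psi A E2 t \<alpha> \<beta> a b)"
      unfolding E2.incl_psi unfolding \<zeta>_incl[symmetric] E1.incl_psi
      by (simp add: \<zeta>_simps \<zeta>_mul t_def)
    then show ?thesis by simp
  qed
  have chi: "chi A E1 s1 \<omega> a = chi A E2 t \<omega> a" for \<omega> a
  proof -
    have "incl E2 \<omega> (chi A E1 s1 \<omega> a) = incl E2 \<omega> (chi A E2 t \<omega> a)"
      unfolding E2.incl_chi unfolding \<zeta>_incl[symmetric] E1.incl_chi
      by (simp add: \<zeta>_simps nfa_morphismD(2)[OF \<zeta>] t_def)
    then show ?thesis by simp
  qed
  have "psi A E1 s1 = psi A E2 t" "chi A E1 s1 = chi A E2 t"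
    and lr: "left_action A E1 = left_action A E2" "right_action A E1 = right_action A E2"
    by (intro ext l r psi chi)+
  \<comment> \<open>An extension enters its class only through the actions and the pair, so the
    classes for \<open>s1\<close> and \<open>t\<close> are equal as sets. Passing from
    \<open>t\<close> to \<open>s2\<close> takes place inside \<open>E2\<close>.\<close>
  then have "extension_class A M E1 s1 = extension_class A M E2 t"
    unfolding extension_class_def by simp
  with lr E1.class_in_H2 E2.extension_class_section[OF assms(6)] show ?thesis by simp
qed

end
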